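(* Let $G$ be the group with presentation $\langle a,b,t \mid [a,b],\ t^{-1}at=b\rangle$, and let $K$ be the subgroup of $G$ generated by $abb$, $t$ and $btat^{-1}b^{-1}$. Then the engulfing property fails for $K$, that is, $K\neq G$ and the only subgroup of finite index of $G$ containing $K$ is $G$ itself.
   Context: Here $[x,y]=x^{-1}y^{-1}xy$, and $abb$ denotes the product $a\cdot b\cdot b$. A subgroup of a group $G$ is engulfed if it is contained in a proper subgroup of finite index in $G$. *)

theory Defs
  imports "HOL-Algebra.Algebra"
begin

text \<open>A word over the alphabet of generators \<open>'x\<close> is a list of letters; the letter \<open>(x, True)\<close>
  stands for \<open>x\<close> and the letter \<open>(x, False)\<close> for the formal inverse of \<open>x\<close>.\<close>

type_synonym 'x word = "('x \<times> bool) list"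

definition winv :: "'x word \<Rightarrow> 'x word" where
  "winv w = rev (map (\<lambda>(x, e). (x, \<not> e)) w)"

definition wcomm :: "'x word \<Rightarrow> 'x word \<Rightarrow> 'x word" where
  "wcomm u v = winv u @ winv v @ u @ v"

text \<open>A set \<open>R\<close> of defining relations consists of pairs \<open>(l, r)\<close>, read as \<open>l = r\<close>; a relator \<open>l\<close>
  is the pair \<open>(l, [])\<close>.  Two words represent the same element of the presented group iff they
  are related by the least congruence of the word monoid that contains \<open>R\<close> and cancels adjacent
  inverse letters.\<close>

inductive weq :: "('x word \<times> 'x word) set \<Rightarrow> 'x word \<Rightarrow> 'x word \<Rightarrow> bool"
  for R :: "('x word \<times> 'x word) set" where
  relation: "(l, r) \<in> R \<Longrightarrow> weq R l r"
| cancel: "weq R [(x, e), (x, \<not> e)] []"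
| refl: "weq R u u"
| sym: "weq R u v \<Longrightarrow> weq R v u"
| trans: "weq R u v \<Longrightarrow> weq R v w \<Longrightarrow> weq R u w"
| append: "weq R u u' \<Longrightarrow> weq R v v' \<Longrightarrow> weq R (u @ v) (u' @ v')"

definition wclass :: "('x word \<times> 'x word) set \<Rightarrow> 'x word \<Rightarrow> 'x word set" where
  "wclass R u = {v. weq R u v}"

text \<open>The alphabet is the whole type \<open>'x\<close>.\<close>

definition presented_group :: "('x word \<times> 'x word) set \<Rightarrow> 'x word set monoid" where
  "presented_group R =
    \<lparr>carrier = range (wclass R),
     monoid.mult = (\<lambda>U V. \<Union>u\<in>U. \<Union>v\<in>V. wclass R (u @ v)),
     monoid.one = wclass R []\<rparr>"

definition generator :: "('x word \<times> 'x word) set \<Rightarrow> 'x \<Rightarrow> 'x word set" where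
  "generator R x = wclass R [(x, True)]"

lemma wclass_self: "u \<in> wclass R u"
  by (simp add: wclass_def weq.refl)

lemma wclass_eq_iff: "wclass R u = wclass R v \<longleftrightarrow> weq R u v"
proof
  assume "wclass R u = wclass R v"
  then have "v \<in> wclass R u" by (simp add: wclass_self)
  then show "weq R u v" by (simp add: wclass_def)
next
  assume uv: "weq R u v"
  have "weq R u w \<longleftrightarrow> weq R v w" for w
    using weq.trans[OF uv, of w] weq.trans[OF weq.sym[OF uv], of w] by iprover
  then show "wclass R u = wclass R v" by (simp add: wclass_def)
qed

lemma presented_group_mult:
  "wclass R u \<otimes>\<^bsub>presented_group R\<^esub> wclass R v = wclass R (u @ v)"
proof -
  have eq: "wclass R (u' @ v') = wclass R (u @ v)"
    if "u' \<in> wclass R u" "v' \<in> wclass R v" for u' v'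
  proof -
    have "weq R u u'" "weq R v v'" using that by (simp_all add: wclass_def)
    then have "weq R (u @ v) (u' @ v')" by (rule weq.append)
    then have "wclass R (u @ v) = wclass R (u' @ v')" by (simp only: wclass_eq_iff)
    then show ?thesis by (rule HOL.sym)
  qed
  have "(\<Union>u'\<in>wclass R u. \<Union>v'\<in>wclass R v. wclass R (u' @ v'))
      = (\<Union>u'\<in>wclass R u. \<Union>v'\<in>wclass R v. wclass R (u @ v))"
    by (intro SUP_cong HOL.refl eq)
  also have "\<dots> = wclass R (u @ v)"
    using wclass_self[of u R] wclass_self[of v R] by blast
  finally show ?thesis by (simp add: presented_group_def)
qed

lemma winv_left: "weq R (winv u @ u) []"
proof (induction u)
  case Nil
  then show ?case by (simp add: winv_def weq.refl)
next
  case (Cons p u)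
  obtain x e where p: "p = (x, e)" by fastforce
  have "weq R [(x, \<not> e), (x, e)] []"
    using weq.cancel[of R x "\<not> e"] by simp
  then have "weq R (winv u @ [(x, \<not> e), (x, e)] @ u) (winv u @ [] @ u)"
    by (intro weq.append weq.refl)
  then have "weq R (winv (p # u) @ p # u) (winv u @ u)"
    by (simp add: winv_def p)
  then show ?case using Cons.IH by (rule weq.trans)
qed

lemma group_presented_group: "group (presented_group R)"
proof (rule groupI)
  fix U V W
  assume "U \<in> carrier (presented_group R)" "V \<in> carrier (presented_group R)"
    "W \<in> carrier (presented_group R)"
  then obtain u v w where "U = wclass R u" "V = wclass R v" "W = wclass R w"
    by (auto simp: presented_group_def)
  then show "U \<otimes>\<^bsub>presented_group R\<^esub> V \<otimes>\<^bsub>presented_group R\<^esub> W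
      = U \<otimes>\<^bsub>presented_group R\<^esub> (V \<otimes>\<^bsub>presented_group R\<^esub> W)"
    by (simp add: presented_group_mult)
next
  fix U V
  assume "U \<in> carrier (presented_group R)" "V \<in> carrier (presented_group R)"
  then obtain u v where "U = wclass R u" "V = wclass R v"
    by (auto simp: presented_group_def)
  then have "U \<otimes>\<^bsub>presented_group R\<^esub> V = wclass R (u @ v)"
    by (simp add: presented_group_mult)
  then show "U \<otimes>\<^bsub>presented_group R\<^esub> V \<in> carrier (presented_group R)"
    by (simp add: presented_group_def)
next
  show "\<one>\<^bsub>presented_group R\<^esub> \<in> carrier (presented_group R)"
    by (simp add: presented_group_def)
next
  fix U
  assume "U \<in> carrier (presented_group R)"
  then obtain u where u: "U = wclass R u"
    by (auto simp: presented_group_def)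
  have one: "\<one>\<^bsub>presented_group R\<^esub> = wclass R []"
    by (simp add: presented_group_def)
  show "\<one>\<^bsub>presented_group R\<^esub> \<otimes>\<^bsub>presented_group R\<^esub> U = U"
    by (simp add: u one presented_group_mult)
  have "wclass R (winv u) \<otimes>\<^bsub>presented_group R\<^esub> U = \<one>\<^bsub>presented_group R\<^esub>"
    by (simp add: u one presented_group_mult wclass_eq_iff winv_left)
  moreover have "wclass R (winv u) \<in> carrier (presented_group R)"
    by (simp add: presented_group_def)
  ultimately show "\<exists>V\<in>carrier (presented_group R).
      V \<otimes>\<^bsub>presented_group R\<^esub> U = \<one>\<^bsub>presented_group R\<^esub>"
    by blast
qed

definition finite_index_subgroup :: "'a set \<Rightarrow> ('a, 'm) monoid_scheme \<Rightarrow> bool" where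
  "finite_index_subgroup H G \<longleftrightarrow> subgroup H G \<and> finite (rcosets\<^bsub>G\<^esub> H)"

definition engulfed :: "'a set \<Rightarrow> ('a, 'm) monoid_scheme \<Rightarrow> bool" where
  "engulfed K G \<longleftrightarrow> (\<exists>H. finite_index_subgroup H G \<and> H \<noteq> carrier G \<and> K \<subseteq> H)"

datatype gens = A | B | T

definition rels :: "(gens word \<times> gens word) set" where
  "rels = {(wcomm [(A, True)] [(B, True)], []),
           ([(T, False), (A, True), (T, True)], [(B, True)])}"

end

theory Submission
  imports Defs
begin

text \<open>
  Let \<open>c = t a t\<inverse>\<close>, so that \<open>c\<close> commutes with \<open>a\<close>, and let \<open>H\<close> be a subgroup of finite index
  containing \<open>K\<close>. Some positive power of \<open>a\<close> lies in \<open>H\<close>. Since \<open>t\<close> and \<open>a b\<^sup>2\<close> lie in \<open>H\<close>,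
  \<open>a\<^sup>k \<in> H\<close> is implied by \<open>b\<^bsup>2k\<^esup> \<in> H\<close>, hence by \<open>a\<^bsup>2k\<^esup> \<in> H\<close>; so the least positive \<open>n\<close> with
  \<open>a\<^sup>n \<in> H\<close> is odd. Writing \<open>n = 2j + 1\<close>, the element \<open>h = a\<^bsup>j+1\<^esup> b\<close> lies in \<open>H\<close>, because \<open>h b\<^sup>n\<close> is
  a power of \<open>a b\<^sup>2\<close>, and \<open>h\<close> conjugates \<open>b c b\<inverse> \<in> H\<close> into \<open>c\<close>. So \<open>H\<close> contains \<open>c\<close>, \<open>a\<close> and \<open>b\<close>.

  To see that \<open>a \<notin> K\<close>, it suffices to let \<open>G\<close> act on a set so that the three generators of \<open>K\<close>,
  but not \<open>a\<close>, fix some point. This is possible on a union of four copies of the integers, on each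
  of which \<open>a\<close> and \<open>b\<close> act by translations.
\<close>

section \<open>Subgroups of finite index\<close>

text \<open>Pigeonhole: two powers \<open>x [^] i\<close> and \<open>x [^] j\<close> with
  \<open>i < j\<close> share a right coset of \<open>H\<close>, and then their quotient lies in
  \<open>H\<close>.\<close>

lemma (in group) finite_index_pow_mem:
  assumes H: "subgroup H G" and fin: "finite (rcosets H)" and x: "x \<in> carrier G"
  shows "\<exists>n>0. x [^] (n::nat) \<in> H"
proof -
  have sub: "H \<subseteq> carrier G" using H by (rule subgroup.subset)
  have "range (\<lambda>k::nat. H #> x [^] k) \<subseteq> rcosets H"
    using x sub by (auto intro: rcosetsI)
  then have "\<not> inj (\<lambda>k::nat. H #> x [^] k)"
    using fin finite_subset finite_imageD infinite_UNIV_nat by blast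
  then obtain i j :: nat where ij: "i < j" "H #> x [^] i = H #> x [^] j"
    unfolding inj_on_def by (metis nat_neq_iff)
  have "x [^] j \<in> H #> x [^] i"
    using ij(2) H x by (simp add: rcos_self)
  then obtain h where h: "h \<in> H" "x [^] j = h \<otimes> x [^] i"
    unfolding r_coset_def by blast
  have "x [^] (j - i) \<otimes> x [^] i = h \<otimes> x [^] i"
    using h(2) ij(1) x by (simp add: nat_pow_mult)
  then have "x [^] (j - i) = h"
    using h(1) sub x by (metis nat_pow_closed r_cancel subsetD)
  then show ?thesis using h(1) ij(1) by (metis zero_less_diff)
qed

lemma (in group) mult_inv_cancel [simp]:
  assumes "x \<in> carrier G" "y \<in> carrier G"
  shows "x \<otimes> (inv x \<otimes> y) = y" and "inv x \<otimes> (x \<otimes> y) = y"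
  using assms by (simp_all flip: m_assoc)

lemma (in group) subgroup_mem_cancel:
  assumes "subgroup H G" "h \<in> H" "x \<in> carrier G"
  shows "h \<otimes> x \<in> H \<longleftrightarrow> x \<in> H" and "x \<otimes> h \<in> H \<longleftrightarrow> x \<in> H"
proof -
  interpret subgroup H G by fact
  have "inv h \<otimes> (h \<otimes> x) = x" "(x \<otimes> h) \<otimes> inv h = x"
    using assms by (simp_all add: m_assoc)
  then show "h \<otimes> x \<in> H \<longleftrightarrow> x \<in> H" "x \<otimes> h \<in> H \<longleftrightarrow> x \<in> H"
    using assms(2) by (metis m_closed m_inv_closed)+
qed

lemma (in group) subgroup_nat_pow_closed:
  assumes "subgroup H G" "x \<in> H"
  shows "x [^] (n::nat) \<in> H"
  using assms by (induction n) (auto simp: subgroup.one_closed subgroup.m_closed)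

lemma (in group) conj_pow:
  assumes "x \<in> carrier G" "t \<in> carrier G"
  shows "(inv t \<otimes> x \<otimes> t) [^] (n::nat) = inv t \<otimes> x [^] n \<otimes> t"
  using assms by (induction n) (simp_all add: m_assoc)

lemma (in group) finite_index_mem:
  assumes H: "subgroup H G" and fin: "finite (rcosets H)"
    and carr: "a \<in> carrier G" "b \<in> carrier G" "t \<in> carrier G"
    and comm: "a \<otimes> b = b \<otimes> a" and conj: "inv t \<otimes> a \<otimes> t = b"
    and abb: "a \<otimes> b \<otimes> b \<in> H" and tH: "t \<in> H"
    and bc: "b \<otimes> t \<otimes> a \<otimes> inv t \<otimes> inv b \<in> H"
  shows "a \<in> H"
proof -
  interpret H: subgroup H G by fact
  note cancel = subgroup_mem_cancel[OF H]
  have b_pow: "b [^] n \<in> H" if "a [^] n \<in> H" for n :: nat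
    using that tH carr by (simp flip: conj add: conj_pow)
  have abb_pow: "(a \<otimes> b \<otimes> b) [^] k = a [^] k \<otimes> b [^] (2 * k)" for k :: nat
  proof -
    have "a \<otimes> (b \<otimes> b) = (b \<otimes> b) \<otimes> a"
      using comm carr by (metis m_assoc)
    then have "(a \<otimes> (b \<otimes> b)) [^] k = a [^] k \<otimes> (b \<otimes> b) [^] k"
      using carr by (intro pow_mult_distrib) auto
    moreover have "(b \<otimes> b) [^] k = b [^] (2 * k)"
      using carr by (metis nat_pow_pow nat_pow_mult nat_pow_eone one_add_one)
    ultimately show ?thesis using carr by (simp add: m_assoc)
  qed
  define n where "n = (LEAST n::nat. n > 0 \<and> a [^] n \<in> H)"
  have n: "n > 0" "a [^] n \<in> H"
    using LeastI_ex[OF finite_index_pow_mem[OF H fin carr(1)]] by (auto simp: n_def)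
  have "odd n"
  proof
    assume "even n"
    then obtain j where j: "n = 2 * j" by blast
    have "a [^] j \<otimes> b [^] n \<in> H"
      using subgroup_nat_pow_closed[OF H abb, of j] by (simp add: abb_pow j)
    then have "a [^] j \<in> H" using cancel(2)[OF b_pow[OF n(2)]] carr by simp
    then have "n \<le> j" using n(1) j unfolding n_def by (intro Least_le) auto
    then show False using n(1) j by simp
  qed
  then obtain j where j: "n = 2 * j + 1" by (metis oddE)
  define p where "p = a [^] Suc j"
  define c where "c = t \<otimes> a \<otimes> inv t"
  have pc: "p \<in> carrier G" "c \<in> carrier G" using carr by (auto simp: p_def c_def)
  \<comment> \<open>Oddness of \<open>n\<close> enters here: \<open>Suc n = 2 * Suc j\<close> is the
    exponent of \<open>b\<close> that matches \<open>Suc j\<close> factors \<open>a\<close>.\<close>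
  have "p \<otimes> b \<otimes> b [^] n = (a \<otimes> b \<otimes> b) [^] Suc j"
  proof -
    have "b \<otimes> b [^] n = b [^] Suc n" using carr nat_pow_Suc2[of b n] by simp
    moreover have "Suc n = 2 * Suc j" using j by simp
    ultimately have "b \<otimes> b [^] n = b [^] (2 * Suc j)" by (simp only:)
    then show ?thesis using carr pc(1) unfolding abb_pow p_def by (simp only: m_assoc nat_pow_closed)
  qed
  then have "p \<otimes> b \<otimes> b [^] n \<in> H" using subgroup_nat_pow_closed[OF H abb] by metis
  then have h: "p \<otimes> b \<in> H" using cancel(2)[OF b_pow[OF n(2)]] carr pc by simp
  have pb: "p \<otimes> b = b \<otimes> p"
    unfolding p_def by (intro group_commutes_pow comm carr)
  \<comment> \<open>Conjugation by \<open>t\<close> carries \<open>b\<close> to \<open>a\<close> and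
    \<open>a\<close> to \<open>c\<close>, so it turns \<open>comm\<close> into the commutation of
    \<open>a\<close> and \<open>c\<close>.\<close>
  have "t \<otimes> b \<otimes> inv t = a"
    using carr by (simp add: m_assoc flip: conj)
  then have "c \<otimes> a = t \<otimes> (a \<otimes> b) \<otimes> inv t" "a \<otimes> c = t \<otimes> (b \<otimes> a) \<otimes> inv t"
    using carr unfolding c_def by (auto simp add: m_assoc)
  then have "a \<otimes> c = c \<otimes> a" using comm by simp
  then have "p \<otimes> c = c \<otimes> p"
    unfolding p_def using carr pc by (intro group_commutes_pow) auto
  \<comment> \<open>Both sides equal \<open>b c p\<close>, as \<open>p\<close> commutes with
    \<open>b\<close> and with \<open>c\<close>.\<close>
  then have "(b \<otimes> c \<otimes> inv b) \<otimes> (p \<otimes> b) = (p \<otimes> b) \<otimes> c"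
    using carr pc by (simp add: pb m_assoc)
  moreover have "b \<otimes> c \<otimes> inv b \<in> H"
    using bc carr by (simp add: c_def m_assoc)
  ultimately have "(p \<otimes> b) \<otimes> c \<in> H" using h by (metis H.m_closed)
  then have "c \<in> H" using cancel(1)[OF h pc(2)] by blast
  then have "inv t \<otimes> c \<otimes> t \<in> H" using tH by simp
  moreover have "inv t \<otimes> c \<otimes> t = a" using carr by (simp add: c_def m_assoc)
  ultimately show ?thesis by simp
qed

section \<open>Presented groups and actions of words\<close>

lemma one_presented_group: "\<one>\<^bsub>presented_group R\<^esub> = wclass R []"
  by (simp add: presented_group_def)

lemma presented_group_subgroup_eq_carrier:
  assumes "subgroup H (presented_group R)" "\<And>x. generator R x \<in> H"
  shows "H = carrier (presented_group R)"
proof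
  interpret H: subgroup H "presented_group R" by fact
  interpret G: group "presented_group R" by (rule group_presented_group)
  show "H \<subseteq> carrier (presented_group R)" by (rule H.subset)
  have inv: "wclass R [(x, False)] = inv\<^bsub>presented_group R\<^esub> (generator R x)" for x
    using weq.cancel[of R x False]
    by (intro G.inv_equality[symmetric])
      (simp_all add: generator_def presented_group_mult wclass_eq_iff one_presented_group,
       simp_all add: presented_group_def)
  have "wclass R [(x, e)] \<in> H" for x e
    using assms(2)[of x] by (cases e) (simp_all add: inv, simp add: generator_def)
  then have "wclass R w \<in> H" for w
  proof (induction w)
    case Nil
    show ?case using H.one_closed by (simp add: presented_group_def)
  next
    case (Cons p w)
    then have "wclass R [p] \<otimes>\<^bsub>presented_group R\<^esub> wclass R w \<in> H"
      by (metis H.m_closed surj_pair)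
    then show ?case by (simp add: presented_group_mult)
  qed
  then show "carrier (presented_group R) \<subseteq> H" by (auto simp: presented_group_def)
qed

lemma inv_presented_group: "inv\<^bsub>presented_group R\<^esub> (wclass R w) = wclass R (winv w)"
  by (intro group.inv_equality group_presented_group)
    (simp_all add: presented_group_mult one_presented_group wclass_eq_iff winv_left,
     simp_all add: presented_group_def)

text \<open>Words act from the right, so the first letter is applied first.\<close>

definition word_act :: "('x \<Rightarrow> 'p \<Rightarrow> 'p) \<Rightarrow> 'x word \<Rightarrow> 'p \<Rightarrow> 'p" where
  "word_act f = fold (\<lambda>(x, e). if e then f x else inv_into UNIV (f x))"

lemma word_act_append: "word_act f (u @ v) p = word_act f v (word_act f u p)"
  by (simp add: word_act_def)

lemma word_act_Nil: "word_act f [] p = p"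
  by (simp add: word_act_def)

text \<open>Bijectivity of the \<open>f x\<close> handles \<open>cancel\<close> and the last
  hypothesis handles \<open>relation\<close>, so the action descends to the presented group.\<close>

lemma word_act_weq:
  assumes "weq R u v" "\<And>x. bij (f x)" "\<And>l r. (l, r) \<in> R \<Longrightarrow> word_act f l = word_act f r"
  shows "word_act f u = word_act f v"
  using assms(1)
proof induction
  case (cancel x e)
  show ?case using assms(2)[of x]
    by (cases e) (auto simp: word_act_def fun_eq_iff bij_is_inj bij_is_surj surj_f_inv_f)
next
  case (relation l r)
  then show ?case by (rule assms(3))
qed (simp_all add: word_act_append fun_eq_iff)

text \<open>The stabiliser of \<open>p\<close> is a subgroup. The induction yields some
  representative of \<open>h\<close> fixing \<open>p\<close>; \<open>word_act_weq\<close> transfers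
  this to the given \<open>w\<close>.\<close>

lemma generate_fixes_point:
  assumes "h \<in> generate (presented_group R) (wclass R ` W)"
    and f: "\<And>x. bij (f x)" "\<And>l r. (l, r) \<in> R \<Longrightarrow> word_act f l = word_act f r"
    and W_fix: "\<And>w. w \<in> W \<Longrightarrow> word_act f w p = p"
    and w: "h = wclass R w"
  shows "word_act f w p = p"
proof -
  have winv_fix: "word_act f (winv u) p = p" if "word_act f u p = p" for u
  proof -
    have "winv (winv u) = u"
      by (simp add: winv_def rev_map comp_def case_prod_beta)
    then have "weq R (u @ winv u) []" using winv_left[of R "winv u"] by simp
    then have "word_act f (u @ winv u) = word_act f []" by (rule word_act_weq[OF _ f])
    then show ?thesis using that word_act_append[of f u "winv u" p] by (simp add: word_act_Nil)
  qed
  from assms(1) have "\<exists>u. h = wclass R u \<and> word_act f u p = p"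
  proof induction
    case one
    show ?case by (intro exI[of _ "[]"] conjI one_presented_group word_act_Nil)
  next
    case (incl h)
    then show ?case using W_fix by blast
  next
    case (inv h)
    then obtain u where "h = wclass R u" "u \<in> W" by blast
    then have "inv\<^bsub>presented_group R\<^esub> h = wclass R (winv u)" "word_act f (winv u) p = p"
      by (simp_all add: inv_presented_group winv_fix W_fix)
    then show ?case by blast
  next
    case (eng h1 h2)
    then obtain u v where "h1 = wclass R u" "word_act f u p = p" "h2 = wclass R v" "word_act f v p = p"
      by blast
    then have "h1 \<otimes>\<^bsub>presented_group R\<^esub> h2 = wclass R (u @ v)" "word_act f (u @ v) p = p"
      by (simp_all add: presented_group_mult word_act_append)
    then show ?case by blast
  qed
  then obtain u where u: "wclass R w = wclass R u" "word_act f u p = p"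
    using w by blast
  have "word_act f w = word_act f u"
    using u(1) by (intro word_act_weq[OF _ f]) (simp only: wclass_eq_iff)
  then show ?thesis using u(2) by simp
qed

section \<open>The separating action\<close>

datatype point = P0 int | P1 int | P2 int | P3 int

text \<open>The shift by -2 on \<open>P0\<close> is chosen to cancel two shifts by
  \<open>actB\<close>, so that \<open>a b b\<close> fixes every point of \<open>P0\<close>.\<close>

fun actA :: "point \<Rightarrow> point" where
  "actA (P0 n) = P0 (n - 2)"
| "actA (P1 n) = P1 n"
| "actA (P2 n) = P2 n"
| "actA (P3 n) = P3 (n + 1)"

fun actA' :: "point \<Rightarrow> point" where
  "actA' (P0 n) = P0 (n + 2)"
| "actA' (P1 n) = P1 n"
| "actA' (P2 n) = P2 n"
| "actA' (P3 n) = P3 (n - 1)"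

fun actB :: "point \<Rightarrow> point" where
  "actB (P0 n) = P0 (n + 1)"
| "actB (P1 n) = P1 (n + 1)"
| "actB (P2 n) = P2 (n + 1)"
| "actB (P3 n) = P3 n"

fun actB' :: "point \<Rightarrow> point" where
  "actB' (P0 n) = P0 (n - 1)"
| "actB' (P1 n) = P1 (n - 1)"
| "actB' (P2 n) = P2 (n - 1)"
| "actB' (P3 n) = P3 n"

text \<open>For \<open>actA\<close> to be conjugate to \<open>actB\<close>, \<open>actT\<close> must carry the \<open>actA\<close>-orbits (evens and odds of
  \<open>P0\<close>, all of \<open>P3\<close>) to the \<open>actB\<close>-orbits \<open>P0\<close>, \<open>P1\<close>, \<open>P2\<close>, and the fixed points of \<open>actA\<close> to those of
  \<open>actB\<close>. The copy \<open>P2\<close> only serves to make the numbers of infinite orbits agree.\<close>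

fun actT :: "point \<Rightarrow> point" where
  "actT (P0 n) = (if even n then P0 (- (n div 2)) else P1 (- (n div 2)))"
| "actT (P1 n) = P3 (2 * n)"
| "actT (P2 n) = P3 (2 * n + 1)"
| "actT (P3 n) = P2 n"

fun actT' :: "point \<Rightarrow> point" where
  "actT' (P0 n) = P0 (- 2 * n)"
| "actT' (P1 n) = P0 (1 - 2 * n)"
| "actT' (P2 n) = P3 n"
| "actT' (P3 n) = (if even n then P1 (n div 2) else P2 (n div 2))"

fun gen_act :: "gens \<Rightarrow> point \<Rightarrow> point" where
  "gen_act A = actA"
| "gen_act B = actB"
| "gen_act T = actT"

fun gen_act' :: "gens \<Rightarrow> point \<Rightarrow> point" where
  "gen_act' A = actA'"
| "gen_act' B = actB'"
| "gen_act' T = actT'"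

lemma gen_act_inverse: "gen_act' x (gen_act x p) = p" "gen_act x (gen_act' x p) = p"
proof -
  have "actT' (actT p) = p" by (cases p) (auto elim: oddE)
  moreover have "actT (actT' p) = p" by (cases p) auto
  moreover have "actA' (actA p) = p" "actA (actA' p) = p" "actB' (actB p) = p" "actB (actB' p) = p"
    by (cases p; simp)+
  ultimately show "gen_act' x (gen_act x p) = p" "gen_act x (gen_act' x p) = p"
    by (cases x; simp)+
qed

lemma bij_gen_act: "bij (gen_act x)"
  by (rule o_bij[of "gen_act' x"]) (simp_all add: fun_eq_iff gen_act_inverse)

lemma inv_gen_act: "inv_into UNIV (gen_act x) = gen_act' x"
  by (rule inv_equality) (simp_all add: gen_act_inverse)

lemma inv_acts: "inv_into UNIV actA = actA'" "inv_into UNIV actB = actB'" "inv_into UNIV actT = actT'"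
  using inv_gen_act[of A] inv_gen_act[of B] inv_gen_act[of T] by simp_all

lemma gen_act_rels:
  assumes "(l, r) \<in> rels"
  shows "word_act gen_act l = word_act gen_act r"
proof -
  \<comment> \<open>In a right action the first letter of the relator is the innermost map.\<close>
  have "actB (actA (actB' (actA' p))) = p" for p by (cases p) auto
  moreover have "actT (actA (actT' p)) = actB p" for p
    by (cases p) auto
  ultimately show ?thesis
    using assms by (auto simp: rels_def wcomm_def winv_def word_act_def inv_acts fun_eq_iff)
qed

theorem theorem2:
  fixes G :: "gens word set monoid" (structure)
    and a b t :: "gens word set"
    and K :: "gens word set set"
  defines "G \<equiv> presented_group rels"
    and "a \<equiv> generator rels A"
    and "b \<equiv> generator rels B"
    and "t \<equiv> generator rels T"
    and "K \<equiv> generate G {a \<otimes> b \<otimes> b, t, b \<otimes> t \<otimes> a \<otimes> inv t \<otimes> inv b}"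
  shows "K \<noteq> carrier G \<and> \<not> engulfed K G \<and>
    (\<forall>H. finite_index_subgroup H G \<and> K \<subseteq> H \<longrightarrow> H = carrier G)"
proof -
  interpret group G unfolding G_def by (rule group_presented_group)
  have carr: "a \<in> carrier G" "b \<in> carrier G" "t \<in> carrier G"
    by (auto simp: G_def a_def b_def t_def generator_def presented_group_def)
  have "weq rels (wcomm [(A, True)] [(B, True)]) []"
    and tat: "weq rels [(T, False), (A, True), (T, True)] [(B, True)]"
    by (rule weq.relation, simp add: rels_def)+
  then have "inv a \<otimes> inv b \<otimes> (a \<otimes> b) = \<one>"
    by (simp add: G_def a_def b_def generator_def inv_presented_group presented_group_mult
        one_presented_group wclass_eq_iff wcomm_def winv_def)
  \<comment> \<open>The relator reads \<open>inv (b a) (a b) = 1\<close>.\<close>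
  then have comm: "a \<otimes> b = b \<otimes> a"
    using carr inv_solve_left'[of \<one> "b \<otimes> a" "a \<otimes> b"] by (simp add: inv_mult_group)
  have conj: "inv t \<otimes> a \<otimes> t = b"
    using tat by (simp add: G_def a_def b_def t_def generator_def inv_presented_group
        presented_group_mult wclass_eq_iff winv_def)
  have eq: "H = carrier G" if "finite_index_subgroup H G" "K \<subseteq> H" for H
  proof -
    have H: "subgroup H G" "finite (rcosets H)"
      using that(1) by (auto simp: finite_index_subgroup_def)
    interpret H: subgroup H G by fact
    have gens: "a \<otimes> b \<otimes> b \<in> H" "t \<in> H" "b \<otimes> t \<otimes> a \<otimes> inv t \<otimes> inv b \<in> H"
      using that(2) by (auto simp: K_def intro: generate.incl)
    have "a \<in> H" using finite_index_mem[OF H carr comm conj gens] .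
    moreover have "b \<in> H" using \<open>a \<in> H\<close> gens(2) by (simp flip: conj)
    ultimately have "generator rels x \<in> H" for x
      using gens(2) by (cases x) (simp_all add: a_def b_def t_def)
    then show ?thesis
      using H(1) unfolding G_def by (intro presented_group_subgroup_eq_carrier)
  qed
  have "a \<notin> K"
  proof
    assume "a \<in> K"
    let ?W = "{[(A, True), (B, True), (B, True)], [(T, True)],
      [(B, True), (T, True), (A, True), (T, False), (B, False)]}"
    have "{a \<otimes> b \<otimes> b, t, b \<otimes> t \<otimes> a \<otimes> inv t \<otimes> inv b} = wclass rels ` ?W"
      by (simp add: G_def a_def b_def t_def generator_def inv_presented_group
          presented_group_mult winv_def)
    then have "a \<in> generate (presented_group rels) (wclass rels ` ?W)"
      using \<open>a \<in> K\<close> by (simp add: K_def G_def)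
    \<comment> \<open>The third generator fixes \<open>P0 0\<close>: \<open>b\<close> and
      \<open>t\<close> lead through \<open>P0 1\<close> to \<open>P1 0\<close>, which
      \<open>a\<close> fixes, and the inverses lead back. But \<open>a\<close> moves
      \<open>P0 0\<close> to \<open>P0 (-2)\<close>.\<close>
    then have "word_act gen_act [(A, True)] (P0 0) = P0 0"
      by (rule generate_fixes_point[OF _ bij_gen_act gen_act_rels])
        (auto simp: a_def generator_def word_act_def inv_acts)
    then show False by (simp add: word_act_def)
  qed
  then show ?thesis using eq carr(1) by (auto simp: engulfed_def)
qed

end
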